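(* Fix an integer $d \geq 2$ and a real number $0 < \lambda < 1$. Then there is a constant $C_\lambda>0$ depending only on $\lambda$ such that for any positive integer $n$ and any $0 < \epsilon < 1$ there exists a polynomial $p(A) = p_{d, \lambda, n, \epsilon}(A)$ in the entries of a $d$-dimensional $n \times \cdots \times n$ tensor $A$ with $\deg p \leq C_\lambda(\ln n - \ln \epsilon)$ and $$|\ln \operatorname{PER}(I + A) - p(A)| \leq \epsilon$$ for every complex $d$-dimensional $n \times \cdots \times n$ tensor $A=(a_{i_1\ldots i_d})$ satisfying $$\sum_{1 \leq i_2, \ldots, i_d \leq n} |a_{i i_2 \ldots i_d}| < \lambda \quad \text{for } i = 1, \ldots, n.$$
   Context: For a $d$-dimensional $n\times\cdots\times n$ complex tensor $B=(b_{i_1\ldots i_d})$, $\operatorname{PER} B = \sum_{\sigma_2, \ldots, \sigma_d \in S_n} \prod_{i=1}^n b_{i\,\sigma_2(i) \ldots \sigma_d(i)}$, where $S_n$ is the symmetric group on $\{1,\ldots,n\}$. $I$ denotes the $d$-dimensional $n\times\cdots\times n$ tensor with $I_{i\ldots i}=1$ for all $i$ and all other entries $0$. On the convex set of complex tensors $A$ with $\sum_{i_2,\ldots,i_d}|a_{i i_2\ldots i_d}|<1$ for every $i$, the function $\operatorname{PER}(I+A)$ does not vanish, and $\ln \operatorname{PER}(I+A)$ denotes the continuous branch of the logarithm on this set with $\ln \operatorname{PER}(I)=0$.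
   Formalization: The degree bound is proved with ln max(2,n) in place of ln n, since for n = 1 and ε near 1 the stated bound forces p constant, which cannot approximate ln(1+a) within ε for all |a| < λ when λ is close to 1; for n ≥ 2 nothing changes. *)

theory Defs
  imports "HOL-Analysis.Analysis" "HOL-Combinatorics.Permutations" "HOL-Library.Poly_Mapping"
begin

definition tensor_indices :: "nat \<Rightarrow> nat \<Rightarrow> nat list set" where
  "tensor_indices d n = {js. length js = d \<and> set js \<subseteq> {1..n}}"

(* Entries outside the index range are pinned to 0, so that this set, with the product
   topology on functions, is a copy of the coordinate space of dimension n^d. *)
definition tensors :: "nat \<Rightarrow> nat \<Rightarrow> (nat list \<Rightarrow> complex) set" where
  "tensors d n = {A. \<forall>js. js \<notin> tensor_indices d n \<longrightarrow> A js = 0}"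

definition id_tensor :: "nat \<Rightarrow> nat \<Rightarrow> nat list \<Rightarrow> complex" where
  "id_tensor d n js = (if \<exists>i\<in>{1..n}. js = replicate d i then 1 else 0)"

definition PER :: "nat \<Rightarrow> nat \<Rightarrow> (nat list \<Rightarrow> complex) \<Rightarrow> complex" where
  "PER d n B =
     (\<Sum>\<sigma> \<in> {2..d} \<rightarrow>\<^sub>E {\<pi>. \<pi> permutes {1..n}}.
        \<Prod>i = 1..n. B (i # map (\<lambda>k. \<sigma> k i) [2..<Suc d]))"

definition slice_norm :: "nat \<Rightarrow> nat \<Rightarrow> (nat list \<Rightarrow> complex) \<Rightarrow> nat \<Rightarrow> real" where
  "slice_norm d n A i = (\<Sum>js \<in> tensor_indices (d - 1) n. cmod (A (i # js)))"

definition dominated_tensors :: "nat \<Rightarrow> nat \<Rightarrow> real \<Rightarrow> (nat list \<Rightarrow> complex) set" where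
  "dominated_tensors d n r = {A \<in> tensors d n. \<forall>i\<in>{1..n}. slice_norm d n A i < r}"

definition is_ln_PER_branch :: "nat \<Rightarrow> nat \<Rightarrow> ((nat list \<Rightarrow> complex) \<Rightarrow> complex) \<Rightarrow> bool" where
  "is_ln_PER_branch d n L \<longleftrightarrow>
     continuous_on (dominated_tensors d n 1) L \<and>
     (\<forall>A \<in> dominated_tensors d n 1. exp (L A) = PER d n (\<lambda>js. id_tensor d n js + A js)) \<and>
     L (\<lambda>_. 0) = 0"

(* The value at A of ln PER(I + A).  A branch is determined only on dominated_tensors d n 1,
   hence the description of the value instead of the function. *)
definition ln_PER :: "nat \<Rightarrow> nat \<Rightarrow> (nat list \<Rightarrow> complex) \<Rightarrow> complex" where
  "ln_PER d n A = (THE w. \<exists>L. is_ln_PER_branch d n L \<and> w = L A)"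

(* Polynomials in variables indexed by 'v: finitely supported coefficient functions on
   monomials, a monomial being a finitely supported exponent function. *)
type_synonym 'v cpoly = "('v \<Rightarrow>\<^sub>0 nat) \<Rightarrow>\<^sub>0 complex"

definition cpoly_vars :: "'v cpoly \<Rightarrow> 'v set" where
  "cpoly_vars p = (\<Union>m \<in> Poly_Mapping.keys p. Poly_Mapping.keys m)"

definition cpoly_degree :: "'v cpoly \<Rightarrow> nat" where
  "cpoly_degree p =
     Max (insert 0 ((\<lambda>m. \<Sum>v \<in> Poly_Mapping.keys m. Poly_Mapping.lookup m v) ` Poly_Mapping.keys p))"

definition cpoly_eval :: "'v cpoly \<Rightarrow> ('v \<Rightarrow> complex) \<Rightarrow> complex" where
  "cpoly_eval p a =
     (\<Sum>m \<in> Poly_Mapping.keys p.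
        Poly_Mapping.lookup p m * (\<Prod>v \<in> Poly_Mapping.keys m. a v ^ Poly_Mapping.lookup m v))"

(* On the degree bound C * (ln (max 2 n) - ln eps): with ln n in place of ln (max 2 n) it would
   force constant polynomials when n = 1 and eps is close to 1, and no constant is within
   distance 1 of ln (1 + a) for all |a| < lambda when lambda is close to 1. *)

end

theory Submission
  imports Defs "HOL-Computational_Algebra.Polynomial_FPS"
    "HOL-Computational_Algebra.Fundamental_Theorem_Algebra"
begin

text \<open>
  \<open>PER (I + A)\<close> is affine in each slice of \<open>A\<close>, and an affine function vanishing somewhere in the
  open unit ball of \<open>\<ell>\<^sup>1\<close> vanishes at a multiple of a unit vector there. So a zero of
  \<open>PER (I + A)\<close> could be moved to a tensor with a single entry \<open>\<alpha>\<^sub>i\<close>, \<open>|\<alpha>\<^sub>i| < 1\<close>, in each slice. For such a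
  tensor \<open>PER (I + A)\<close> is the sum of \<open>\<Prod>i\<in>S. \<alpha>\<^sub>i\<close> over the sets \<open>S\<close> that every one of \<open>d - 1\<close> given
  maps permutes; these sets form a ring of sets, so the sum is the product of
  \<open>1 + (\<Prod>i\<in>Q. \<alpha>\<^sub>i)\<close> over the atoms \<open>Q\<close>, hence nonzero.

  Consequently \<open>z \<mapsto> PER (I + z A)\<close> is a polynomial of degree at most \<open>n\<close> of the form
  \<open>\<Prod>j. (1 - b\<^sub>j z)\<close> with all \<open>|b\<^sub>j| < \<lambda>\<close>, and \<open>\<Sum>j. Ln (1 - b\<^sub>j)\<close> differs from
  \<open>- (\<Sum>k=1..m. (\<Sum>j. b\<^sub>j\<^sup>k) / k)\<close> by at most \<open>n \<lambda>\<^sup>m\<^sup>+\<^sup>1 / (1 - \<lambda>)\<close>. By Newton's identities the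
  power sum of order \<open>k\<close> is a polynomial of degree \<open>k\<close> in the entries of \<open>A\<close>; the same estimate makes
  \<open>\<Sum>j. Ln (1 - b\<^sub>j)\<close> a locally uniform limit of polynomials, hence the continuous branch.
\<close>

subsection \<open>Polynomial functions\<close>

definition monom_eval :: "('v \<Rightarrow>\<^sub>0 nat) \<Rightarrow> ('v \<Rightarrow> complex) \<Rightarrow> complex" where
  "monom_eval m a = (\<Prod>v \<in> Poly_Mapping.keys m. a v ^ Poly_Mapping.lookup m v)"

definition monom_degree :: "('v \<Rightarrow>\<^sub>0 nat) \<Rightarrow> nat" where
  "monom_degree m = (\<Sum>v \<in> Poly_Mapping.keys m. Poly_Mapping.lookup m v)"

text \<open>A predicate on functions, because the power sums below are known only by their values
  and a recursion; a witness with bounded degree suffices and coefficients need not be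
  computed.\<close>

definition poly_fun :: "'v set \<Rightarrow> nat \<Rightarrow> (('v \<Rightarrow> complex) \<Rightarrow> complex) \<Rightarrow> bool" where
  "poly_fun V k g \<longleftrightarrow>
     (\<exists>p. cpoly_vars p \<subseteq> V \<and> cpoly_degree p \<le> k \<and> (\<forall>a. cpoly_eval p a = g a))"

text \<open>Variables outside the support contribute zeroth powers, hence factors 1. This allows two
  monomials to be compared over one common set.\<close>

lemma monom_eval_superset:
  assumes "finite V" "Poly_Mapping.keys m \<subseteq> V"
  shows "monom_eval m a = (\<Prod>v\<in>V. a v ^ Poly_Mapping.lookup m v)"
  unfolding monom_eval_def using assms
  by (intro prod.mono_neutral_left) (auto simp: in_keys_iff)

lemma monom_degree_superset:
  assumes "finite V" "Poly_Mapping.keys m \<subseteq> V"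
  shows "monom_degree m = (\<Sum>v\<in>V. Poly_Mapping.lookup m v)"
  unfolding monom_degree_def using assms
  by (intro sum.mono_neutral_left) (auto simp: in_keys_iff)

lemma monom_eval_add: "monom_eval (m + m') a = monom_eval m a * monom_eval m' a"
proof -
  let ?V = "Poly_Mapping.keys m \<union> Poly_Mapping.keys m'"
  have "Poly_Mapping.keys (m + m') \<subseteq> ?V" by (rule keys_add)
  then show ?thesis
    by (simp add: monom_eval_superset[of ?V] lookup_add power_add prod.distrib)
qed

lemma monom_degree_add: "monom_degree (m + m') = monom_degree m + monom_degree m'"
proof -
  let ?V = "Poly_Mapping.keys m \<union> Poly_Mapping.keys m'"
  have "Poly_Mapping.keys (m + m') \<subseteq> ?V" by (rule keys_add)
  then show ?thesis
    by (simp add: monom_degree_superset[of ?V] lookup_add sum.distrib)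
qed

lemma cpoly_eval_superset:
  assumes "finite M" "Poly_Mapping.keys p \<subseteq> M"
  shows "cpoly_eval p a = (\<Sum>m\<in>M. Poly_Mapping.lookup p m * monom_eval m a)"
  unfolding cpoly_eval_def monom_eval_def[symmetric] using assms
  by (intro sum.mono_neutral_left) (auto simp: in_keys_iff)

lemma cpoly_degree_le_iff:
  "cpoly_degree p \<le> k \<longleftrightarrow> (\<forall>m\<in>Poly_Mapping.keys p. monom_degree m \<le> k)"
  by (auto simp: cpoly_degree_def monom_degree_def)

lemma poly_fun_monom:
  assumes "Poly_Mapping.keys m \<subseteq> V" "monom_degree m \<le> k"
  shows "poly_fun V k (\<lambda>a. c * monom_eval m a)"
  unfolding poly_fun_def
proof (intro exI conjI allI)
  let ?p = "Poly_Mapping.single m c"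
  show "cpoly_vars ?p \<subseteq> V" "cpoly_degree ?p \<le> k"
    using assms by (auto simp: cpoly_vars_def cpoly_degree_le_iff split: if_splits)
  show "cpoly_eval ?p a = c * monom_eval m a" for a
    by (subst cpoly_eval_superset[of "{m}"]) auto
qed

lemma poly_fun_add:
  assumes "poly_fun V k g" "poly_fun V k h"
  shows "poly_fun V k (\<lambda>a. g a + h a)"
proof -
  obtain p q where p: "cpoly_vars p \<subseteq> V" "cpoly_degree p \<le> k" "\<And>a. cpoly_eval p a = g a"
    and q: "cpoly_vars q \<subseteq> V" "cpoly_degree q \<le> k" "\<And>a. cpoly_eval q a = h a"
    using assms unfolding poly_fun_def by blast
  let ?M = "Poly_Mapping.keys p \<union> Poly_Mapping.keys q"
  have keys: "Poly_Mapping.keys (p + q) \<subseteq> ?M" by (rule keys_add)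
  show ?thesis
    unfolding poly_fun_def
  proof (intro exI conjI allI)
    show "cpoly_vars (p + q) \<subseteq> V"
      using p(1) q(1) keys unfolding cpoly_vars_def by blast
    show "cpoly_degree (p + q) \<le> k"
      using p(2) q(2) keys by (auto simp: cpoly_degree_le_iff)
    show "cpoly_eval (p + q) a = g a + h a" for a
      using keys
      by (simp add: cpoly_eval_superset[of ?M] lookup_add algebra_simps sum.distrib flip: p(3) q(3))
  qed
qed

lemma poly_fun_const [simp]: "poly_fun V k (\<lambda>_. c)"
  using poly_fun_monom[of 0 V k c] by (simp add: monom_eval_def monom_degree_def)

lemma poly_fun_var:
  assumes "v \<in> V" "k \<ge> 1"
  shows "poly_fun V k (\<lambda>a. a v)"
  using poly_fun_monom[of "Poly_Mapping.single v 1" V k 1] assms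
  by (simp add: monom_eval_def monom_degree_def)

lemma poly_fun_sum:
  assumes "\<And>x. x \<in> X \<Longrightarrow> poly_fun V k (g x)"
  shows "poly_fun V k (\<lambda>a. \<Sum>x\<in>X. g x a)"
  using assms by (induction X rule: infinite_finite_induct) (auto intro: poly_fun_add)

lemma poly_fun_mono: "poly_fun V k g \<Longrightarrow> k \<le> l \<Longrightarrow> poly_fun V l g"
  unfolding poly_fun_def by (meson order_trans)

text \<open>The product is expanded into a double sum of monomials, so each term falls under
  \<open>poly_fun_monom\<close> and no product of coefficient functions is formed.\<close>

lemma poly_fun_mult:
  assumes "poly_fun V k g" "poly_fun V l h"
  shows "poly_fun V (k + l) (\<lambda>a. g a * h a)"
proof -
  obtain p q where p: "cpoly_vars p \<subseteq> V" "cpoly_degree p \<le> k" "\<And>a. cpoly_eval p a = g a"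
    and q: "cpoly_vars q \<subseteq> V" "cpoly_degree q \<le> l" "\<And>a. cpoly_eval q a = h a"
    using assms unfolding poly_fun_def by blast
  have "g a * h a = (\<Sum>m\<in>Poly_Mapping.keys p. \<Sum>m'\<in>Poly_Mapping.keys q.
      (Poly_Mapping.lookup p m * Poly_Mapping.lookup q m') * monom_eval (m + m') a)" for a
    by (simp add: cpoly_eval_superset[OF _ order_refl] sum_product monom_eval_add mult_ac
        flip: p(3) q(3))
  moreover have "poly_fun V (k + l) (\<lambda>a. (Poly_Mapping.lookup p m * Poly_Mapping.lookup q m') *
      monom_eval (m + m') a)"
    if "m \<in> Poly_Mapping.keys p" "m' \<in> Poly_Mapping.keys q" for m m'
  proof (rule poly_fun_monom)
    show "Poly_Mapping.keys (m + m') \<subseteq> V"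
      using keys_add[of m m'] p(1) q(1) that unfolding cpoly_vars_def by blast
    show "monom_degree (m + m') \<le> k + l"
      using p(2) q(2) that by (simp add: monom_degree_add cpoly_degree_le_iff add_mono)
  qed
  ultimately show ?thesis
    by (auto intro!: poly_fun_sum)
qed

lemma poly_fun_cmult: "poly_fun V k g \<Longrightarrow> poly_fun V k (\<lambda>a. c * g a)"
  using poly_fun_mult[OF poly_fun_const[of V 0 c]] by simp

lemma poly_fun_continuous_on:
  assumes "poly_fun V k g"
  shows "continuous_on S g"
proof -
  obtain p where "\<And>a. cpoly_eval p a = g a"
    using assms unfolding poly_fun_def by blast
  moreover have "continuous_on S (\<lambda>a. cpoly_eval p a)"
    unfolding cpoly_eval_def
    by (intro continuous_intros continuous_on_subset[OF continuous_on_product_coordinates]) auto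
  ultimately show ?thesis by simp
qed

subsection \<open>Reciprocal roots and power sums\<close>

text \<open>Induction on the degree: a complex root \<open>z\<close> exists, is nonzero because the
  constant coefficient is 1, and contributes \<open>b = 1 / z\<close>.\<close>

lemma recip_root_factorization:
  fixes p :: "complex poly"
  assumes "coeff p 0 = 1"
  shows "\<exists>bs. length bs = degree p \<and> p = (\<Prod>b\<leftarrow>bs. [:1, - b:])"
  using assms
proof (induction "degree p" arbitrary: p)
  case 0
  then obtain c where "p = [:c:]" by (metis degree_eq_zeroE)
  with 0 show ?case by (auto intro!: exI[of _ "[]"])
next
  case (Suc k)
  then have "\<not> constant (poly p)" by (simp add: constant_degree)
  then obtain z where z: "poly p z = 0" using fundamental_theorem_of_algebra by blast
  with Suc.prems have "z \<noteq> 0" by (auto simp: poly_0_coeff_0)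
  obtain q where q: "p = [:-z, 1:] * q" using z by (metis dvdE poly_eq_0_iff_dvd)
  \<comment> \<open>Moving the scalar \<open>-z\<close> from the linear factor into the quotient
    gives both factors constant coefficient 1, as the induction requires.\<close>
  define q' where "q' = smult (-z) q"
  have p: "p = [:1, - (1 / z):] * q'"
  proof -
    have "[:1, - (1 / z):] * smult (- z) q = smult (- z) [:1, - (1 / z):] * q"
      by (simp only: mult_smult_left mult_smult_right)
    also have "smult (- z) [:1, - (1 / z):] = [:- z, 1:]"
      using \<open>z \<noteq> 0\<close> by simp
    finally show ?thesis by (simp only: q q'_def)
  qed
  have "coeff q' 0 = 1" using Suc.prems p by (simp add: coeff_mult)
  then have "q' \<noteq> 0" by auto
  then have "degree p = Suc (degree q')"
    using \<open>z \<noteq> 0\<close> by (subst p, subst degree_mult_eq) auto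
  then obtain bs where bs: "length bs = degree q'" "q' = (\<Prod>b\<leftarrow>bs. [:1, - b:])"
    using Suc \<open>coeff q' 0 = 1\<close> by (metis Suc_inject)
  then show ?case
    using p \<open>degree p = Suc (degree q')\<close> by (intro exI[of _ "1 / z # bs"]) simp
qed

text \<open>A list, so that multiplicities are kept. Its order is arbitrary, which is harmless since
  only symmetric expressions in its members are formed.\<close>

definition recip_roots :: "complex poly \<Rightarrow> complex list" where
  "recip_roots p = (SOME bs. length bs = degree p \<and> p = (\<Prod>b\<leftarrow>bs. [:1, - b:]))"

lemma recip_roots:
  assumes "coeff p 0 = 1"
  shows "length (recip_roots p) = degree p" "p = (\<Prod>b\<leftarrow>recip_roots p. [:1, - b:])"
  using someI_ex[OF recip_root_factorization[OF assms]] unfolding recip_roots_def by auto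

lemma poly_prod_list: "poly (prod_list ps) x = (\<Prod>p\<leftarrow>ps. poly p x)"
  by (induction ps) auto

text \<open>If |b| \<ge> r, then \<open>1 / b\<close> would be a zero in the closed disc of radius
  \<open>1 / r\<close>.\<close>

lemma norm_recip_roots_less:
  assumes "coeff p 0 = 1" "r > 0" "\<And>z. cmod z \<le> 1 / r \<Longrightarrow> poly p z \<noteq> 0"
    "b \<in> set (recip_roots p)"
  shows "cmod b < r"
proof (rule ccontr)
  assume "\<not> cmod b < r"
  then have "b \<noteq> 0" "cmod (1 / b) \<le> 1 / r"
    using assms(2) by (auto simp: norm_divide not_less intro!: divide_left_mono mult_pos_pos)
  moreover have "poly (\<Prod>b\<leftarrow>recip_roots p. [:1, - b:]) (1 / b) = 0"
    using assms(4) \<open>b \<noteq> 0\<close> by (auto simp: poly_prod_list prod_list_zero_iff o_def image_iff intro!: bexI[of _ b])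
  ultimately show False
    using assms(1,3) recip_roots(2) by metis
qed

section \<open>Power sums and Newton's identities\<close>

definition power_sum :: "complex poly \<Rightarrow> nat \<Rightarrow> complex" where
  "power_sum p k = (\<Sum>b\<leftarrow>recip_roots p. b ^ k)"

text \<open>Logarithmic derivative: each factor contributes -b / (1 - b X), a geometric series. The
  identity is kept multiplied by the product, so that the induction never divides.\<close>

lemma Newton_fps:
  fixes bs :: "complex list"
  shows "fps_deriv (\<Prod>b\<leftarrow>bs. 1 - fps_const b * fps_X) =
    - (\<Prod>b\<leftarrow>bs. 1 - fps_const b * fps_X) * Abs_fps (\<lambda>k. \<Sum>b\<leftarrow>bs. b ^ Suc k)"
proof (induction bs)
  case Nil
  then show ?case by (simp add: fps_eq_iff)
next
  case (Cons b bs)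
  let ?G = "\<Prod>b\<leftarrow>bs. 1 - fps_const b * fps_X"
  let ?S = "\<lambda>bs. Abs_fps (\<lambda>k. \<Sum>b\<leftarrow>bs. b ^ Suc k)"
  let ?g = "Abs_fps (\<lambda>k. b ^ Suc k)"
  have S: "?S (b # bs) = ?g + ?S bs"
    by (rule fps_ext) simp
  \<comment> \<open>The series \<open>?g\<close> telescopes against 1 - b X; it plays the part of b
    / (1 - b X).\<close>
  have g: "(1 - fps_const b * fps_X) * ?g = fps_const b"
  proof (rule fps_ext)
    show "fps_nth ((1 - fps_const b * fps_X) * ?g) k = fps_nth (fps_const b) k" for k
      by (cases k) (simp_all add: ring_distribs mult.assoc)
  qed
  have "fps_deriv ((1 - fps_const b * fps_X) * ?G)
      = (1 - fps_const b * fps_X) * fps_deriv ?G + (- fps_const b) * ?G"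
    by simp
  also have "\<dots> = - (?G * fps_const b) - (1 - fps_const b * fps_X) * ?G * ?S bs"
    unfolding Cons by (simp add: mult.commute mult.left_commute del: fps_const_neg)
  also have "\<dots> = - ((1 - fps_const b * fps_X) * ?G) * ?S (b # bs)"
  proof -
    have "- (G * (U * g)) - U * G * T = - (U * G) * (g + T)" for G U g T :: "complex fps"
      by (simp add: algebra_simps)
    from this[of ?G "1 - fps_const b * fps_X" ?g "?S bs"] show ?thesis
      unfolding S g .
  qed
  finally show ?case by simp
qed

lemma fps_of_poly_prod_recip:
  "fps_of_poly (\<Prod>b\<leftarrow>bs. [:1, - b:]) = (\<Prod>b\<leftarrow>bs. 1 - fps_const b * fps_X)"
  for bs :: "complex list"
proof (induction bs)
  case (Cons b bs)
  have "fps_of_poly [:1, - b:] = 1 - fps_const b * fps_X"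
    by (simp add: fps_of_poly_pCons)
  then show ?case
    unfolding list.map prod_list.Cons fps_of_poly_mult Cons by simp
qed simp

text \<open>Compare coefficients in \<open>Newton_fps\<close> and solve for the term i = k, whose
  factor is \<open>coeff p 0 = 1\<close>. The recursion shows that power sums of arbitrarily chosen
  roots are polynomials in the coefficients.\<close>

lemma power_sum_Newton:
  assumes "coeff p 0 = 1"
  shows "power_sum p (Suc k) =
    - (of_nat (Suc k) * coeff p (Suc k)) - (\<Sum>i<k. power_sum p (Suc i) * coeff p (k - i))"
proof -
  let ?S = "Abs_fps (\<lambda>k. power_sum p (Suc k))"
  have "fps_deriv (fps_of_poly p) = - fps_of_poly p * ?S"
    using Newton_fps[of "recip_roots p"]
    unfolding fps_of_poly_prod_recip[symmetric] recip_roots(2)[OF assms, symmetric]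
      power_sum_def[symmetric] .
  then have "fps_nth (fps_deriv (fps_of_poly p)) k = - fps_nth (?S * fps_of_poly p) k"
    by (simp add: mult.commute)
  then have "of_nat (Suc k) * coeff p (Suc k) = - (\<Sum>i\<le>k. power_sum p (Suc i) * coeff p (k - i))"
    by (simp add: fps_mult_nth atLeast0AtMost)
  moreover have "(\<Sum>i\<le>k. power_sum p (Suc i) * coeff p (k - i)) =
      (\<Sum>i<k. power_sum p (Suc i) * coeff p (k - i)) + power_sum p (Suc k)"
    using assms by (simp flip: lessThan_Suc_atMost)
  ultimately show ?thesis by (simp add: eq_neg_iff_add_eq_0 algebra_simps)
qed

text \<open>The remainder of the logarithmic series is bounded by a geometric tail once the
  denominators, all at least 1, are dropped.\<close>

lemma norm_Ln_truncation_le: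
  assumes "cmod b \<le> r" "r < 1"
  shows "cmod (Ln (1 - b) + (\<Sum>k=1..m. b ^ k / of_nat k)) \<le> r ^ Suc m / (1 - r)"
proof -
  let ?f = "\<lambda>k. b ^ k / of_nat k"
  have r: "0 \<le> r" using assms(1) norm_ge_zero order_trans by blast
  have "?f sums - Ln (1 - b)"
    using sums_minus[OF Ln_series'[of "- b"]] assms by simp
  then have "(\<lambda>k. ?f (k + Suc m)) sums (- Ln (1 - b) - (\<Sum>k<Suc m. ?f k))"
    by (rule sums_split_initial_segment)
  \<comment> \<open>The term k = 0 is a division by zero and hence 0, so starting at 0 or at 1 makes
    no difference.\<close>
  moreover have "(\<Sum>k<Suc m. ?f k) = (\<Sum>k=1..m. ?f k)"
    by (rule sum.mono_neutral_right) (auto simp: not_le)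
  ultimately have s: "(\<lambda>k. ?f (k + Suc m)) sums (- (Ln (1 - b) + (\<Sum>k=1..m. ?f k)))"
    by (simp add: algebra_simps)
  have geo: "(\<lambda>k. r ^ Suc m * r ^ k) sums (r ^ Suc m * (1 / (1 - r)))"
    using r assms(2) by (intro sums_mult geometric_sums) simp
  have "cmod (?f (k + Suc m)) \<le> r ^ Suc m * r ^ k" for k
  proof -
    have "cmod (?f (k + Suc m)) = cmod b ^ (k + Suc m) / real (k + Suc m)"
      by (simp only: norm_divide norm_power norm_of_nat)
    also have "\<dots> \<le> cmod b ^ (k + Suc m) / 1"
      by (rule divide_left_mono) auto
    also have "\<dots> \<le> r ^ (k + Suc m)"
      using assms(1) by (simp add: power_mono del: power_Suc add_Suc_right)
    finally show ?thesis by (simp add: power_add mult_ac)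
  qed
  then have "cmod (suminf (\<lambda>k. ?f (k + Suc m))) \<le> suminf (\<lambda>k. r ^ Suc m * r ^ k)"
    using geo sums_summable by (intro norm_suminf_le) blast+
  then show ?thesis
    unfolding sums_unique[OF s, symmetric] sums_unique[OF geo, symmetric] by (simp only: norm_minus_cancel) simp
qed

lemma norm_sum_Ln_truncation_le:
  assumes "\<And>b. b \<in> set bs \<Longrightarrow> cmod b \<le> r" "r < 1"
  shows "cmod ((\<Sum>b\<leftarrow>bs. Ln (1 - b)) + (\<Sum>k=1..m. (\<Sum>b\<leftarrow>bs. b ^ k) / of_nat k))
    \<le> real (length bs) * (r ^ Suc m / (1 - r))"
  using assms(1)
proof (induction bs)
  case (Cons b bs)
  have "(\<Sum>b\<leftarrow>b # bs. Ln (1 - b)) + (\<Sum>k=1..m. (\<Sum>b\<leftarrow>b # bs. b ^ k) / of_nat k)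
      = (Ln (1 - b) + (\<Sum>k=1..m. b ^ k / of_nat k))
      + ((\<Sum>b\<leftarrow>bs. Ln (1 - b)) + (\<Sum>k=1..m. (\<Sum>b\<leftarrow>bs. b ^ k) / of_nat k))"
    by (simp add: add_divide_distrib sum.distrib)
  also have "cmod \<dots> \<le> r ^ Suc m / (1 - r) + real (length bs) * (r ^ Suc m / (1 - r))"
    using Cons assms(2) by (intro norm_triangle_mono norm_Ln_truncation_le) auto
  also have "\<dots> = real (length (b # bs)) * (r ^ Suc m / (1 - r))"
    by (simp add: ring_distribs add_divide_distrib)
  finally show ?case .
qed simp

subsection \<open>Nonvanishing\<close>

text \<open>A minimal nonempty member \<open>Q\<close> is contained in or disjoint from every
  member, so the members avoiding \<open>Q\<close>, with and without \<open>Q\<close> added, make up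
  the ring. This splits off the factor 1 + (product over \<open>Q\<close>), nonzero because a
  nonempty product of numbers of modulus below 1 has modulus below 1.\<close>

lemma sum_prod_ring_of_sets_nonzero:
  fixes \<alpha> :: "'i \<Rightarrow> complex"
  assumes "finite R" "{} \<in> R" "\<And>S. S \<in> R \<Longrightarrow> finite S"
    "\<And>S T. S \<in> R \<Longrightarrow> T \<in> R \<Longrightarrow> S - T \<in> R" "\<And>S T. S \<in> R \<Longrightarrow> T \<in> R \<Longrightarrow> S \<union> T \<in> R"
    "\<And>i. cmod (\<alpha> i) < 1"
  shows "(\<Sum>S\<in>R. \<Prod>i\<in>S. \<alpha> i) \<noteq> 0"
  using assms(1-5)
proof (induction "card R" arbitrary: R rule: less_induct)
  case less
  show ?case
  proof (cases "R = {{}}")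
    case True
    then show ?thesis by simp
  next
    case False
    with less.prems(2) obtain Q where "Q \<in> R" "Q \<noteq> {}" by blast
    then obtain Q where Q: "Q \<in> R - {{}}" and minQ: "\<And>S. S \<in> R - {{}} \<Longrightarrow> S \<subseteq> Q \<Longrightarrow> S = Q"
      using finite_has_minimal2[of "R - {{}}" Q] less.prems(1) by (metis Diff_iff finite_Diff singletonD)
    have "finite Q" "Q \<noteq> {}" using Q less.prems(3) by auto
    \<comment> \<open>By minimality the member \<open>Q - S\<close> is either empty or all of
      \<open>Q\<close>.\<close>
    have dich: "Q \<subseteq> S \<or> Q \<inter> S = {}" if "S \<in> R" for S
      using minQ[of "Q - S"] that Q less.prems(4) by blast
    define R' where "R' = {S \<in> R. Q \<inter> S = {}}"
    have "R' \<subset> R" using Q by (auto simp: R'_def)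
    have R: "R = R' \<union> (\<union>) Q ` R'"
    proof (intro set_eqI iffI)
      fix S assume "S \<in> R"
      show "S \<in> R' \<union> (\<union>) Q ` R'"
      proof (cases "Q \<subseteq> S")
        case True
        then have "S = Q \<union> (S - Q)" "S - Q \<in> R'"
          using Q \<open>S \<in> R\<close> less.prems(4) by (auto simp: R'_def)
        then show ?thesis by blast
      qed (use dich \<open>S \<in> R\<close> in \<open>auto simp: R'_def\<close>)
    qed (use Q less.prems(5) in \<open>auto simp: R'_def\<close>)
    have "finite R'" using \<open>R' \<subset> R\<close> less.prems(1) by (meson finite_subset psubset_imp_subset)
    have "inj_on ((\<union>) Q) R'" by (auto simp: inj_on_def R'_def)
    have "(\<Sum>S\<in>R. \<Prod>i\<in>S. \<alpha> i) = (\<Sum>S\<in>R'. \<Prod>i\<in>S. \<alpha> i) + (\<Sum>S\<in>(\<union>) Q ` R'. \<Prod>i\<in>S. \<alpha> i)"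
      using \<open>finite R'\<close> \<open>Q \<noteq> {}\<close> by (subst R, intro sum.union_disjoint) (auto simp: R'_def)
    also have "(\<Sum>S\<in>(\<union>) Q ` R'. \<Prod>i\<in>S. \<alpha> i) = (\<Sum>S\<in>R'. \<Prod>i\<in>Q \<union> S. \<alpha> i)"
      using \<open>inj_on ((\<union>) Q) R'\<close> by (simp add: sum.reindex)
    also have "\<dots> = (\<Sum>S\<in>R'. (\<Prod>i\<in>Q. \<alpha> i) * (\<Prod>i\<in>S. \<alpha> i))"
      using \<open>finite Q\<close> less.prems(3) by (intro sum.cong refl prod.union_disjoint) (auto simp: R'_def)
    also have "(\<Sum>S\<in>R'. \<Prod>i\<in>S. \<alpha> i) + \<dots> = (1 + (\<Prod>i\<in>Q. \<alpha> i)) * (\<Sum>S\<in>R'. \<Prod>i\<in>S. \<alpha> i)"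
      by (simp only: distrib_right sum_distrib_left mult_1 sum.distrib)
    finally have "(\<Sum>S\<in>R. \<Prod>i\<in>S. \<alpha> i) = (1 + (\<Prod>i\<in>Q. \<alpha> i)) * (\<Sum>S\<in>R'. \<Prod>i\<in>S. \<alpha> i)" .
    moreover have "(\<Sum>S\<in>R'. \<Prod>i\<in>S. \<alpha> i) \<noteq> 0"
    proof (rule less.hyps)
      show "card R' < card R" using \<open>R' \<subset> R\<close> less.prems(1) by (rule psubset_card_mono[rotated])
    qed (use less.prems \<open>finite R'\<close> in \<open>auto simp: R'_def\<close>)
    moreover have "1 + (\<Prod>i\<in>Q. \<alpha> i) \<noteq> 0"
    proof
      assume "1 + (\<Prod>i\<in>Q. \<alpha> i) = 0"
      then have "(\<Prod>i\<in>Q. \<alpha> i) = - 1" by (simp add: add_eq_0_iff)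
      then have "(\<Prod>i\<in>Q. cmod (\<alpha> i)) = 1" by (simp add: prod_norm)
      moreover obtain q where "q \<in> Q" using \<open>Q \<noteq> {}\<close> by blast
      then have "(\<Prod>i\<in>Q. cmod (\<alpha> i)) = cmod (\<alpha> q) * (\<Prod>i\<in>Q - {q}. cmod (\<alpha> i))"
        using \<open>finite Q\<close> by (simp add: prod.remove)
      moreover have "(\<Prod>i\<in>Q - {q}. cmod (\<alpha> i)) \<le> 1"
        using assms(6) by (intro prod_le_1) (auto intro: less_imp_le)
      moreover have "(\<Prod>i\<in>Q - {q}. cmod (\<alpha> i)) \<ge> 0" by (simp add: prod_nonneg)
      ultimately show False
        using assms(6)[of q] by (smt (verit) mult_left_le norm_ge_zero)
    qed
    ultimately show ?thesis by simp
  qed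
qed

text \<open>Take \<open>j\<close> with |G j| maximal. Then |c| is at most |G j| times the norm of
  \<open>A\<close>, so \<open>- c / G j\<close> has modulus below 1; if \<open>G j = 0\<close>, then
  \<open>c = 0\<close> and \<alpha> = 0 works.\<close>

lemma affine_zero_at_single_entry:
  fixes c :: complex and A G :: "'j \<Rightarrow> complex"
  assumes "finite J" "J \<noteq> {}" "(\<Sum>j\<in>J. cmod (A j)) < 1" "c + (\<Sum>j\<in>J. A j * G j) = 0"
  obtains j \<alpha> where "j \<in> J" "cmod \<alpha> < 1" "c + \<alpha> * G j = 0"
proof -
  let ?M = "Max ((\<lambda>i. cmod (G i)) ` J)"
  have "?M \<in> (\<lambda>i. cmod (G i)) ` J" using assms(1,2) by (intro Max_in) auto
  then obtain j where "j \<in> J" "?M = cmod (G j)" by (rule imageE)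
  then have j: "j \<in> J" "\<And>i. i \<in> J \<Longrightarrow> cmod (G i) \<le> cmod (G j)"
    using assms(1) by (metis Max_ge finite_imageI imageI)+
  have "cmod c = cmod (\<Sum>j\<in>J. A j * G j)"
    using assms(4) by (metis add_eq_0_iff2 norm_minus_cancel)
  also have "\<dots> \<le> (\<Sum>i\<in>J. cmod (A i) * cmod (G j))"
    using j by (intro sum_norm_le) (simp add: norm_mult mult_left_mono)
  finally have le: "cmod c \<le> (\<Sum>i\<in>J. cmod (A i)) * cmod (G j)"
    by (simp add: sum_distrib_right)
  show thesis
  proof (cases "G j = 0")
    case True
    with le have "c = 0" by simp
    then show thesis using j(1) by (intro that[of j 0]) auto
  next
    case False
    then have "cmod (- c / G j) \<le> (\<Sum>i\<in>J. cmod (A i))"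
      using le by (simp add: norm_divide divide_le_eq)
    then show thesis
      using False assms(3) j(1) by (intro that[of j "- c / G j"]) auto
  qed
qed

text \<open>\<open>w \<sigma> i\<close> is the entry of row \<open>i\<close> picked by the configuration \<open>\<sigma>\<close>, and \<open>j\<^sub>0 i\<close> the position of
  the diagonal entry of row \<open>i\<close>.\<close>

lemma zero_with_single_entry_rows:
  fixes w :: "'s \<Rightarrow> 'i \<Rightarrow> 'j" and A :: "'i \<Rightarrow> 'j \<Rightarrow> complex" and j\<^sub>0 :: "'i \<Rightarrow> 'j"
    and \<Sigma> :: "'s set" and N :: "'i set"
  defines "P \<equiv> \<lambda>A. \<Sum>\<sigma>\<in>\<Sigma>. \<Prod>i\<in>N. (of_bool (w \<sigma> i = j\<^sub>0 i) + A i (w \<sigma> i))"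
  assumes "finite N" "finite J" "J \<noteq> {}"
    and w: "\<And>\<sigma> i. \<sigma> \<in> \<Sigma> \<Longrightarrow> i \<in> N \<Longrightarrow> w \<sigma> i \<in> J"
    and A: "\<And>i. i \<in> N \<Longrightarrow> (\<Sum>j\<in>J. cmod (A i j)) < 1" "P A = 0"
  obtains \<alpha> \<tau> where "\<And>i. i \<in> N \<Longrightarrow> \<tau> i \<in> J" "\<And>i. cmod (\<alpha> i) < 1"
    "P (\<lambda>i j. \<alpha> i * of_bool (j = \<tau> i)) = 0"
proof -
  \<comment> \<open>Rows are replaced one at a time; \<open>M\<close> holds the rows already reduced
    to a single entry. All rows keep norm below 1, so the next row can be treated.\<close>
  have "\<exists>A' \<alpha> \<tau>. (\<forall>i\<in>N. (\<Sum>j\<in>J. cmod (A' i j)) < 1) \<and> P A' = 0 \<and>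
      (\<forall>i\<in>M. \<tau> i \<in> J \<and> cmod (\<alpha> i) < 1 \<and> A' i = (\<lambda>j. \<alpha> i * of_bool (j = \<tau> i)))"
    if "M \<subseteq> N" for M
    using finite_subset[OF that \<open>finite N\<close>] that
  proof (induction M rule: finite_induct)
    case empty
    then show ?case using A by auto
  next
    case (insert m M)
    then have "M \<subseteq> N" by simp
    from insert.IH[OF this] obtain A' \<alpha> \<tau>
      where A': "\<forall>i\<in>N. (\<Sum>j\<in>J. cmod (A' i j)) < 1" "P A' = 0"
        and row: "\<forall>i\<in>M. \<tau> i \<in> J \<and> cmod (\<alpha> i) < 1 \<and> A' i = (\<lambda>j. \<alpha> i * of_bool (j = \<tau> i))"
      by (elim exE conjE)
    define rest where "rest \<sigma> = (\<Prod>i\<in>N - {m}. (of_bool (w \<sigma> i = j\<^sub>0 i) + A' i (w \<sigma> i)))" for \<sigma>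
    define c where "c = (\<Sum>\<sigma>\<in>\<Sigma>. of_bool (w \<sigma> m = j\<^sub>0 m) * rest \<sigma>)"
    define G where "G j = (\<Sum>\<sigma>\<in>\<Sigma>. of_bool (w \<sigma> m = j) * rest \<sigma>)" for j
    have m: "m \<in> N" using insert by auto
    \<comment> \<open>Each product contains exactly one factor from row \<open>m\<close>, so
      \<open>P\<close> is affine in that row.\<close>
    have expand: "P (A'(m := a)) = c + (\<Sum>j\<in>J. a j * G j)" for a
    proof -
      have "(\<Prod>i\<in>N. (of_bool (w \<sigma> i = j\<^sub>0 i) + (A'(m := a)) i (w \<sigma> i)))
          = of_bool (w \<sigma> m = j\<^sub>0 m) * rest \<sigma> + (\<Sum>j\<in>J. a j * (of_bool (w \<sigma> m = j) * rest \<sigma>))"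
        if "\<sigma> \<in> \<Sigma>" for \<sigma>
      proof -
        have "(\<Prod>i\<in>N. (of_bool (w \<sigma> i = j\<^sub>0 i) + (A'(m := a)) i (w \<sigma> i)))
            = (of_bool (w \<sigma> m = j\<^sub>0 m) + a (w \<sigma> m)) * rest \<sigma>"
          unfolding rest_def using m \<open>finite N\<close> by (subst prod.remove[of N m]) auto
        also have "a (w \<sigma> m) = (\<Sum>j\<in>J. a j * of_bool (w \<sigma> m = j))"
          using w[OF that m] \<open>finite J\<close> by (simp add: of_bool_def if_distrib sum.delta cong: if_cong)
        finally show ?thesis by (simp add: ring_distribs sum_distrib_right mult.assoc)
      qed
      then have "P (A'(m := a)) = c + (\<Sum>\<sigma>\<in>\<Sigma>. \<Sum>j\<in>J. a j * (of_bool (w \<sigma> m = j) * rest \<sigma>))"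
        by (simp add: P_def c_def sum.distrib)
      also have "(\<Sum>\<sigma>\<in>\<Sigma>. \<Sum>j\<in>J. a j * (of_bool (w \<sigma> m = j) * rest \<sigma>)) = (\<Sum>j\<in>J. a j * G j)"
        unfolding G_def sum_distrib_left by (rule sum.swap)
      finally show ?thesis .
    qed
    have "c + (\<Sum>j\<in>J. A' m j * G j) = 0"
      using expand[of "A' m"] A'(2) by simp
    then obtain j a where ja: "j \<in> J" "cmod a < 1" "c + a * G j = 0"
      using affine_zero_at_single_entry[OF \<open>finite J\<close> \<open>J \<noteq> {}\<close> bspec[OF A'(1) m]] by metis
    let ?row = "\<lambda>j'. a * of_bool (j' = j)"
    have single: "(\<Sum>j'\<in>J. a * of_bool (j' = j) * g j') = a * g j" for g :: "'j \<Rightarrow> complex"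
      using ja(1) \<open>finite J\<close> by (simp add: of_bool_def if_distrib if_distribR sum.delta cong: if_cong)
    have "(\<Sum>j'\<in>J. cmod (?row j')) = cmod a"
      using ja(1) \<open>finite J\<close>
      by (simp add: norm_mult of_bool_def if_distrib sum.delta cong: if_cong)
    then have "\<forall>i\<in>N. (\<Sum>j\<in>J. cmod ((A'(m := ?row)) i j)) < 1"
      using A'(1) ja(2) by simp
    moreover have "P (A'(m := ?row)) = 0"
      using ja(3) by (simp only: expand single)
    moreover have "\<forall>i\<in>insert m M. (\<tau>(m := j)) i \<in> J \<and> cmod ((\<alpha>(m := a)) i) < 1 \<and>
        (A'(m := ?row)) i = (\<lambda>j'. (\<alpha>(m := a)) i * of_bool (j' = (\<tau>(m := j)) i))"
      using row ja insert.hyps(2) by auto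
    ultimately show ?case by blast
  qed
  from this[OF order_refl] obtain A' \<alpha> \<tau> where *: "P A' = 0"
    "\<forall>i\<in>N. \<tau> i \<in> J \<and> cmod (\<alpha> i) < 1 \<and> A' i = (\<lambda>j. \<alpha> i * of_bool (j = \<tau> i))"
    by (elim exE conjE)
  \<comment> \<open>The value 0 off \<open>N\<close> makes the bound |\<alpha> i| < 1 hold at every
    index, as the conclusion demands.\<close>
  let ?\<alpha> = "\<lambda>i. if i \<in> N then \<alpha> i else 0"
  have "P (\<lambda>i j. ?\<alpha> i * of_bool (j = \<tau> i)) = P A'"
    unfolding P_def using *(2) by (intro sum.cong prod.cong) auto
  with * show thesis by (intro that[of \<tau> ?\<alpha>]) auto
qed

section \<open>Configurations of permutations and the sets they leave invariant\<close>

definition configs :: "nat \<Rightarrow> nat \<Rightarrow> (nat \<Rightarrow> nat \<Rightarrow> nat) set" where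
  "configs d n = {2..d} \<rightarrow>\<^sub>E {\<pi>. \<pi> permutes {1..n}}"

definition config_entry :: "nat \<Rightarrow> (nat \<Rightarrow> nat \<Rightarrow> nat) \<Rightarrow> nat \<Rightarrow> nat list" where
  "config_entry d \<sigma> i = map (\<lambda>k. \<sigma> k i) [2..<Suc d]"

lemma PER_configs: "PER d n B = (\<Sum>\<sigma>\<in>configs d n. \<Prod>i=1..n. B (i # config_entry d \<sigma> i))"
  by (simp add: PER_def configs_def config_entry_def)

lemma id_tensor_Cons:
  assumes "d \<ge> 1" "i \<in> {1..n}"
  shows "id_tensor d n (i # js) = of_bool (js = replicate (d - 1) i)"
  using assms by (cases d) (auto simp: id_tensor_def)

lemma finite_tensor_indices: "finite (tensor_indices d n)"
  using finite_lists_length_eq[of "{1..n}" d] by (simp add: tensor_indices_def conj_commute)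

lemma config_entry_in_tensor_indices:
  assumes "\<sigma> \<in> configs d n" "i \<in> {1..n}"
  shows "config_entry d \<sigma> i \<in> tensor_indices (d - 1) n"
proof -
  have "\<sigma> k i \<in> {1..n}" if "k \<in> {2..d}" for k
    using assms that permutes_in_image[of "\<sigma> k" "{1..n}" i]
    unfolding configs_def by (metis PiE_mem mem_Collect_eq)
  then show ?thesis
    by (auto simp: tensor_indices_def config_entry_def)
qed

lemma Cons_config_entry_in_tensor_indices:
  assumes "d \<ge> 1" "\<sigma> \<in> configs d n" "i \<in> {1..n}"
  shows "i # config_entry d \<sigma> i \<in> tensor_indices d n"
  using config_entry_in_tensor_indices[OF assms(2,3)] assms(1,3)
  by (auto simp: tensor_indices_def)

text \<open>The shift by 2 arises because the permutations are numbered from 2 and list positions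
  from 0.\<close>

lemma config_entry_eq_iff:
  assumes "length js = d - 1"
  shows "config_entry d \<sigma> i = js \<longleftrightarrow> (\<forall>k\<in>{2..d}. \<sigma> k i = js ! (k - 2))"
proof
  assume eq: "config_entry d \<sigma> i = js"
  show "\<forall>k\<in>{2..d}. \<sigma> k i = js ! (k - 2)"
  proof
    fix k assume "k \<in> {2..d}"
    then have "k - 2 < Suc d - 2" "2 + (k - 2) = k" by auto
    then show "\<sigma> k i = js ! (k - 2)"
      unfolding eq[symmetric] config_entry_def by (simp del: upt_Suc)
  qed
next
  assume "\<forall>k\<in>{2..d}. \<sigma> k i = js ! (k - 2)"
  then have "\<sigma> (2 + t) i = js ! t" if "t < d - 1" for t
    using that bspec[of "{2..d}" _ "2 + t"] by auto
  then show "config_entry d \<sigma> i = js"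
    using assms by (intro nth_equalityI) (auto simp: config_entry_def simp del: upt_Suc)
qed

text \<open>Prescribing the entry of every row determines each permutation on all of {1..n}: given
  by \<tau> on \<open>S\<close>, the identity elsewhere. Hence at most one configuration agrees, and
  one exists exactly when each of these maps sends \<open>S\<close> onto itself.\<close>

lemma count_configs:
  assumes "S \<subseteq> {1..n}" "\<And>i. i \<in> {1..n} \<Longrightarrow> length (\<tau> i) = d - 1"
  shows "(\<Sum>\<sigma>\<in>configs d n. of_bool ((\<forall>i\<in>S. config_entry d \<sigma> i = \<tau> i) \<and>
       (\<forall>i\<in>{1..n} - S. config_entry d \<sigma> i = replicate (d - 1) i)))
    = (of_bool (\<forall>k\<in>{2..d}. (\<lambda>i. \<tau> i ! (k - 2)) ` S = S) :: complex)"
    (is "(\<Sum>\<sigma>\<in>_. of_bool (?agree \<sigma>)) = of_bool ?R")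
proof -
  let ?N = "{1..n}"
  define \<pi> where "\<pi> k i = (if i \<in> S then \<tau> i ! (k - 2) else i)" for k i
  have agree: "?agree \<sigma> \<longleftrightarrow> (\<forall>k\<in>{2..d}. \<forall>i\<in>?N. \<sigma> k i = \<pi> k i)" for \<sigma>
  proof -
    have "?agree \<sigma> \<longleftrightarrow> (\<forall>i\<in>?N. config_entry d \<sigma> i = (if i \<in> S then \<tau> i else replicate (d - 1) i))"
      using assms(1) by auto
    also have "\<dots> \<longleftrightarrow> (\<forall>i\<in>?N. \<forall>k\<in>{2..d}. \<sigma> k i = \<pi> k i)"
    proof (rule ball_cong[OF refl])
      fix i assume "i \<in> ?N"
      then have "length (if i \<in> S then \<tau> i else replicate (d - 1) i) = d - 1"
        using assms(2) by simp
      from config_entry_eq_iff[OF this]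
      show "config_entry d \<sigma> i = (if i \<in> S then \<tau> i else replicate (d - 1) i) \<longleftrightarrow>
          (\<forall>k\<in>{2..d}. \<sigma> k i = \<pi> k i)"
        by (auto simp: \<pi>_def)
    qed
    finally show ?thesis by blast
  qed
  show ?thesis
  proof (cases ?R)
    case True
    \<comment> \<open>Configurations are extensional in \<open>k\<close>, so uniqueness requires the
      restriction to {2..d}.\<close>
    define \<sigma>\<^sub>0 where "\<sigma>\<^sub>0 = restrict \<pi> {2..d}"
    have perm: "\<pi> k permutes ?N" if "k \<in> {2..d}" for k
    proof (rule bij_imp_permutes)
      have "\<pi> k ` ?N = \<pi> k ` S \<union> \<pi> k ` (?N - S)" using assms(1) by blast
      also have "\<pi> k ` S = (\<lambda>i. \<tau> i ! (k - 2)) ` S" by (simp add: \<pi>_def)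
      also have "\<dots> = S" using True that by blast
      also have "\<pi> k ` (?N - S) = ?N - S" by (simp add: \<pi>_def)
      finally have "\<pi> k ` ?N = ?N" using assms(1) by blast
      then show "bij_betw (\<pi> k) ?N ?N"
        by (simp add: bij_betw_def finite_surj_inj)
      show "\<pi> k i = i" if "i \<notin> ?N" for i
        using that assms(1) by (auto simp: \<pi>_def)
    qed
    have "?agree \<sigma> \<longleftrightarrow> \<sigma> = \<sigma>\<^sub>0" if \<sigma>: "\<sigma> \<in> configs d n" for \<sigma>
    proof
      assume ag: "?agree \<sigma>"
      show "\<sigma> = \<sigma>\<^sub>0"
      proof (intro ext)
        fix k i
        show "\<sigma> k i = \<sigma>\<^sub>0 k i"
        proof (cases "k \<in> {2..d}")
          case k: True
          then have "\<sigma> k permutes ?N" using \<sigma> unfolding configs_def by auto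
          then show ?thesis
            using k ag perm[OF k] unfolding agree \<sigma>\<^sub>0_def
            by (cases "i \<in> ?N") (auto simp: permutes_not_in)
        next
          case False
          then have "\<sigma> k = undefined" using \<sigma> unfolding configs_def by (auto simp: PiE_def extensional_def)
          then show ?thesis using False by (auto simp: \<sigma>\<^sub>0_def)
        qed
      qed
    next
      assume "\<sigma> = \<sigma>\<^sub>0"
      then show "?agree \<sigma>" unfolding agree by (simp add: \<sigma>\<^sub>0_def)
    qed
    moreover have "\<sigma>\<^sub>0 \<in> configs d n" using perm by (auto simp: \<sigma>\<^sub>0_def configs_def)
    moreover have "finite (configs d n)"
      unfolding configs_def by (intro finite_PiE finite_permutations) auto
    moreover have "(\<Sum>\<sigma>\<in>configs d n. of_bool (?agree \<sigma>)) =
        (\<Sum>\<sigma>\<in>configs d n. if \<sigma> = \<sigma>\<^sub>0 then 1 else 0 :: complex)"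
      using calculation(1) by (intro sum.cong refl) (simp only: of_bool_def)
    ultimately have "(\<Sum>\<sigma>\<in>configs d n. of_bool (?agree \<sigma>)) = (1 :: complex)"
      by (simp only: sum.delta if_True)
    then show ?thesis by (simp only: of_bool_def[of ?R] if_P[OF True])
  next
    case False
    have "\<not> ?agree \<sigma>" if \<sigma>: "\<sigma> \<in> configs d n" for \<sigma>
    proof
      assume ag: "?agree \<sigma>"
      have "(\<lambda>i. \<tau> i ! (k - 2)) ` S = S" if k: "k \<in> {2..d}" for k
      proof -
        have p: "\<sigma> k permutes ?N" using \<sigma> k unfolding configs_def by auto
        \<comment> \<open>The permutation is the identity off \<open>S\<close>, so it preserves the
          complement of \<open>S\<close> and, being bijective, also \<open>S\<close>.\<close>
        have "\<sigma> k ` (?N - S) = ?N - S"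
          using ag k unfolding agree by (auto simp: \<pi>_def)
        moreover have "\<sigma> k ` (?N - S) = ?N - \<sigma> k ` S"
          using p assms(1) by (simp add: image_set_diff permutes_inj permutes_image)
        moreover have "\<sigma> k ` S \<subseteq> ?N"
          using p assms(1) permutes_image by blast
        ultimately have "\<sigma> k ` S = S" using assms(1) by (metis double_diff order_refl)
        moreover have "\<sigma> k ` S = (\<lambda>i. \<tau> i ! (k - 2)) ` S"
          using ag k assms(1) unfolding agree by (intro image_cong) (auto simp: \<pi>_def)
        ultimately show ?thesis by simp
      qed
      with False show False by blast
    qed
    then have "(\<Sum>\<sigma>\<in>configs d n. of_bool (?agree \<sigma>)) = (0 :: complex)"
      by (intro sum.neutral ballI) (simp only: of_bool_eq)
    then show ?thesis by (simp only: of_bool_def[of ?R] if_not_P[OF False])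
  qed
qed

lemma prod_of_bool: "finite X \<Longrightarrow> (\<Prod>x\<in>X. of_bool (P x)) = (of_bool (\<forall>x\<in>X. P x) :: complex)"
  by (induction X rule: finite_induct) auto

text \<open>A map of the finite set \<open>S\<close> onto itself is injective. It sends
  \<open>S \<inter> T\<close> into itself, hence onto itself, and so the rest of \<open>S\<close>
  onto itself.\<close>

lemma image_Diff_invariant:
  assumes "finite S" "f ` S = S" "f ` T = T"
  shows "f ` (S - T) = S - T"
proof -
  have "inj_on f S" using assms(1,2) by (simp add: eq_card_imp_inj_on)
  have "f ` (S \<inter> T) \<subseteq> S \<inter> T" using assms(2,3) by blast
  then have "f ` (S \<inter> T) = S \<inter> T"
    using \<open>inj_on f S\<close> assms(1) by (intro endo_inj_surj) (auto intro: inj_on_subset)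
  moreover have "f ` (S - S \<inter> T) = f ` S - f ` (S \<inter> T)"
    using \<open>inj_on f S\<close> by (intro inj_on_image_set_diff[of _ S]) auto
  ultimately show ?thesis using assms(2) by (simp add: Diff_Int_distrib Diff_Int)
qed

text \<open>Expand each product over the set \<open>S\<close> of rows that use the entry \<alpha>
  and sum over the configurations first: \<open>count_configs\<close> leaves exactly the sets
  invariant under all the maps, and these form a ring of sets.\<close>

lemma single_entry_nonzero:
  assumes \<tau>: "\<And>i. i \<in> {1..n} \<Longrightarrow> length (\<tau> i) = d - 1" and \<alpha>: "\<And>i. cmod (\<alpha> i) < 1"
  shows "(\<Sum>\<sigma>\<in>configs d n. \<Prod>i=1..n. (of_bool (config_entry d \<sigma> i = replicate (d - 1) i) +
    \<alpha> i * of_bool (config_entry d \<sigma> i = \<tau> i))) \<noteq> 0"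
proof -
  let ?N = "{1..n}"
  let ?agree = "\<lambda>S \<sigma>. (\<forall>i\<in>S. config_entry d \<sigma> i = \<tau> i) \<and>
       (\<forall>i\<in>{1..n} - S. config_entry d \<sigma> i = replicate (d - 1) i)"
  define R where "R = {S \<in> Pow ?N. \<forall>k\<in>{2..d}. (\<lambda>i. \<tau> i ! (k - 2)) ` S = S}"
  have "(\<Prod>i=1..n. (of_bool (config_entry d \<sigma> i = replicate (d - 1) i) +
      \<alpha> i * of_bool (config_entry d \<sigma> i = \<tau> i)))
    = (\<Sum>S\<in>Pow ?N. (\<Prod>i\<in>S. \<alpha> i) * of_bool (?agree S \<sigma>))" for \<sigma>
  proof -
    have "(\<Prod>i=1..n. (of_bool (config_entry d \<sigma> i = replicate (d - 1) i) +
        \<alpha> i * of_bool (config_entry d \<sigma> i = \<tau> i)))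
      = (\<Sum>S\<in>Pow ?N. (\<Prod>i\<in>S. \<alpha> i * of_bool (config_entry d \<sigma> i = \<tau> i)) *
          (\<Prod>i\<in>?N - S. of_bool (config_entry d \<sigma> i = replicate (d - 1) i)))"
      by (subst add.commute) (rule prod_add, simp)
    also have "\<dots> = (\<Sum>S\<in>Pow ?N. (\<Prod>i\<in>S. \<alpha> i) * of_bool (?agree S \<sigma>))"
    proof (rule sum.cong[OF refl])
      fix S assume "S \<in> Pow ?N"
      then have "finite S" by (simp add: finite_subset)
      then show "(\<Prod>i\<in>S. \<alpha> i * of_bool (config_entry d \<sigma> i = \<tau> i)) *
          (\<Prod>i\<in>?N - S. of_bool (config_entry d \<sigma> i = replicate (d - 1) i))
        = (\<Prod>i\<in>S. \<alpha> i) * of_bool (?agree S \<sigma>)"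
        by (simp only: prod.distrib prod_of_bool finite_Diff finite_atLeastAtMost of_bool_conj mult.assoc)
    qed
    finally show ?thesis .
  qed
  then have "(\<Sum>\<sigma>\<in>configs d n. \<Prod>i=1..n. (of_bool (config_entry d \<sigma> i = replicate (d - 1) i) +
      \<alpha> i * of_bool (config_entry d \<sigma> i = \<tau> i)))
    = (\<Sum>\<sigma>\<in>configs d n. \<Sum>S\<in>Pow ?N. (\<Prod>i\<in>S. \<alpha> i) * of_bool (?agree S \<sigma>))"
    by simp
  also have "\<dots> = (\<Sum>S\<in>Pow ?N. (\<Prod>i\<in>S. \<alpha> i) * (\<Sum>\<sigma>\<in>configs d n. of_bool (?agree S \<sigma>)))"
    unfolding sum_distrib_left by (rule sum.swap)
  also have "\<dots> = (\<Sum>S\<in>Pow ?N. (\<Prod>i\<in>S. \<alpha> i) *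
      of_bool (\<forall>k\<in>{2..d}. (\<lambda>i. \<tau> i ! (k - 2)) ` S = S))"
    using count_configs[OF _ \<tau>] by (intro sum.cong refl) (simp only: Pow_iff)
  also have "\<dots> = (\<Sum>S\<in>R. \<Prod>i\<in>S. \<alpha> i)"
    unfolding R_def by (intro sum.mono_neutral_cong_right) auto
  also have "\<dots> \<noteq> 0"
  proof (rule sum_prod_ring_of_sets_nonzero)
    show "S - T \<in> R" if "S \<in> R" "T \<in> R" for S T
    proof -
      have "finite S" using that(1) finite_subset[of S ?N] by (simp add: R_def)
      then have "(\<lambda>i. \<tau> i ! (k - 2)) ` (S - T) = S - T" if "k \<in> {2..d}" for k
        using \<open>S \<in> R\<close> \<open>T \<in> R\<close> that by (intro image_Diff_invariant) (simp_all add: R_def)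
      then show ?thesis using that by (auto simp only: R_def mem_Collect_eq Pow_iff)
    qed
    show "S \<union> T \<in> R" if "S \<in> R" "T \<in> R" for S T
      using that by (simp add: R_def image_Un)
  qed (use \<alpha> in \<open>auto simp: R_def intro: finite_subset\<close>)
  finally show ?thesis .
qed

text \<open>A zero would be carried by \<open>zero_with_single_entry_rows\<close> to a tensor with
  one entry per slice, contradicting \<open>single_entry_nonzero\<close>.\<close>

lemma PER_nonzero:
  assumes "d \<ge> 1" "n \<ge> 1" "A \<in> dominated_tensors d n 1"
  shows "PER d n (\<lambda>js. id_tensor d n js + A js) \<noteq> 0"
proof
  let ?J = "tensor_indices (d - 1) n"
  assume "PER d n (\<lambda>js. id_tensor d n js + A js) = 0"
  moreover have "PER d n (\<lambda>js. id_tensor d n js + A js) = (\<Sum>\<sigma>\<in>configs d n.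
      \<Prod>i\<in>{1..n}. (of_bool (config_entry d \<sigma> i = replicate (d - 1) i) + A (i # config_entry d \<sigma> i)))"
    unfolding PER_configs by (intro sum.cong prod.cong refl) (simp only: id_tensor_Cons[OF assms(1)])
  ultimately have 0: "(\<Sum>\<sigma>\<in>configs d n. \<Prod>i\<in>{1..n}.
      (of_bool (config_entry d \<sigma> i = replicate (d - 1) i) + A (i # config_entry d \<sigma> i))) = 0"
    by simp
  have "replicate (d - 1) 1 \<in> ?J" using assms(2) by (auto simp: tensor_indices_def)
  then have "?J \<noteq> {}" by blast
  have rows: "(\<Sum>j\<in>?J. cmod (A (i # j))) < 1" if "i \<in> {1..n}" for i
    using assms(3) that by (simp add: dominated_tensors_def slice_norm_def)
  show False
  proof (rule zero_with_single_entry_rows[OF finite_atLeastAtMost finite_tensor_indices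
        \<open>?J \<noteq> {}\<close> config_entry_in_tensor_indices rows 0])
    fix \<alpha> \<tau>
    assume \<tau>: "\<And>i. i \<in> {1..n} \<Longrightarrow> \<tau> i \<in> ?J" and \<alpha>: "\<And>i. cmod (\<alpha> i) < 1"
      and "(\<Sum>\<sigma>\<in>configs d n. \<Prod>i\<in>{1..n}. (of_bool (config_entry d \<sigma> i = replicate (d - 1) i) +
        \<alpha> i * of_bool (config_entry d \<sigma> i = \<tau> i))) = 0"
    moreover have "length (\<tau> i) = d - 1" if "i \<in> {1..n}" for i
      using \<tau>[OF that] by (simp add: tensor_indices_def)
    ultimately show False using single_entry_nonzero[of n \<tau> d \<alpha>] by simp
  qed
qed

subsection \<open>The permanent along a line\<close>

text \<open>A formal polynomial in \<open>z\<close>, to give access to degree, coefficients and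
  reciprocal roots of PER (I + z A).\<close>

definition line_poly :: "nat \<Rightarrow> nat \<Rightarrow> (nat list \<Rightarrow> complex) \<Rightarrow> complex poly" where
  "line_poly d n A = (\<Sum>\<sigma>\<in>configs d n. \<Prod>i=1..n.
     [:id_tensor d n (i # config_entry d \<sigma> i), A (i # config_entry d \<sigma> i):])"

lemma poly_line_poly: "poly (line_poly d n A) z = PER d n (\<lambda>js. id_tensor d n js + z * A js)"
  by (simp add: line_poly_def PER_configs poly_sum poly_prod)

text \<open>At z = 0 only the configuration of identity permutations contributes: the case
  \<open>S = {}\<close> of \<open>count_configs\<close>.\<close>

lemma coeff_0_line_poly:
  assumes "d \<ge> 1"
  shows "coeff (line_poly d n A) 0 = 1"
proof -
  have "coeff (line_poly d n A) 0 = poly (line_poly d n A) 0"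
    by (simp add: poly_0_coeff_0)
  also have "\<dots> = (\<Sum>\<sigma>\<in>configs d n. \<Prod>i=1..n. of_bool (config_entry d \<sigma> i = replicate (d - 1) i))"
    using assms by (simp add: poly_line_poly PER_configs id_tensor_Cons)
  also have "\<dots> = (\<Sum>\<sigma>\<in>configs d n. of_bool (\<forall>i\<in>{1..n}. config_entry d \<sigma> i = replicate (d - 1) i))"
    by (simp only: prod_of_bool finite_atLeastAtMost)
  also have "\<dots> = 1"
    using count_configs[of "{}" n "\<lambda>i. replicate (d - 1) i" d] by simp
  finally show ?thesis .
qed

lemma degree_line_poly_le: "degree (line_poly d n A) \<le> n"
  unfolding line_poly_def
proof (rule degree_sum_le)
  show "finite (configs d n)"
    unfolding configs_def by (intro finite_PiE finite_permutations) auto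
  fix \<sigma>
  let ?f = "\<lambda>i. [:id_tensor d n (i # config_entry d \<sigma> i), A (i # config_entry d \<sigma> i):]"
  have "degree (\<Prod>i=1..n. ?f i) \<le> (\<Sum>i=1..n. (degree \<circ> ?f) i)"
    by (rule degree_prod_sum_le) simp
  also have "\<dots> \<le> (\<Sum>i=1..n. 1)" by (rule sum_mono) simp
  finally show "degree (\<Prod>i=1..n. ?f i) \<le> n" by simp
qed

text \<open>Each term of the coefficient of order \<open>k\<close> takes the variable from exactly
  \<open>k\<close> of the linear factors.\<close>

lemma poly_fun_coeff_prod:
  assumes "finite N" "\<And>i. i \<in> N \<Longrightarrow> v i \<in> V"
  shows "poly_fun V k (\<lambda>a. coeff (\<Prod>i\<in>N. [:c i, a (v i):]) k)"
  using assms
proof (induction N arbitrary: k rule: finite_induct)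
  case empty
  then show ?case by simp
next
  case (insert i N)
  have *: "poly_fun V k (\<lambda>a. c i * coeff (\<Prod>i\<in>N. [:c i, a (v i):]) k)" for k
    using insert by (intro poly_fun_cmult) auto
  show ?case
  proof (cases k)
    case 0
    then show ?thesis using *[of 0] insert.hyps by simp
  next
    case (Suc l)
    have "poly_fun V (1 + l) (\<lambda>a. a (v i) * coeff (\<Prod>i\<in>N. [:c i, a (v i):]) l)"
      using insert by (intro poly_fun_mult poly_fun_var) auto
    with *[of k] show ?thesis
      using insert.hyps Suc by (simp add: poly_fun_add)
  qed
qed

lemma poly_fun_coeff_line_poly:
  assumes "d \<ge> 1"
  shows "poly_fun (tensor_indices d n) k (\<lambda>A. coeff (line_poly d n A) k)"
  unfolding line_poly_def coeff_sum
  using Cons_config_entry_in_tensor_indices[OF assms]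
  by (intro poly_fun_sum poly_fun_coeff_prod) auto

text \<open>Newton's recursion respects weights: the summand \<open>i\<close> has degree at most
  \<open>Suc i + (k - i) = Suc k\<close>.\<close>

lemma poly_fun_power_sum_line_poly:
  assumes "d \<ge> 1"
  shows "poly_fun (tensor_indices d n) (Suc k) (\<lambda>A. power_sum (line_poly d n A) (Suc k))"
proof (induction k rule: less_induct)
  case (less k)
  let ?V = "tensor_indices d n"
  let ?c = "\<lambda>A. coeff (line_poly d n A)"
  let ?s = "\<lambda>A. power_sum (line_poly d n A)"
  have "poly_fun ?V (Suc k) (\<lambda>A. ?s A (Suc i) * ?c A (k - i))" if "i < k" for i
    using poly_fun_mult[OF less[OF that] poly_fun_coeff_line_poly[OF assms, of n "k - i"]] that
    by simp
  then have "poly_fun ?V (Suc k) (\<lambda>A. (- of_nat (Suc k)) * ?c A (Suc k)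
      + (- 1) * (\<Sum>i<k. ?s A (Suc i) * ?c A (k - i)))"
    using poly_fun_coeff_line_poly[OF assms]
    by (intro poly_fun_add poly_fun_cmult poly_fun_sum) auto
  moreover have "?s A (Suc k) = (- of_nat (Suc k)) * ?c A (Suc k)
      + (- 1) * (\<Sum>i<k. ?s A (Suc i) * ?c A (k - i))" for A
    using power_sum_Newton[OF coeff_0_line_poly[OF assms], of n A k]
    by (simp only: mult_minus_left mult_1 diff_conv_add_uminus)
  ultimately show ?case by (simp only:)
qed

subsection \<open>The branch of the logarithm\<close>

lemma dominated_tensors_mono: "r \<le> s \<Longrightarrow> dominated_tensors d n r \<subseteq> dominated_tensors d n s"
  by (force simp: dominated_tensors_def)

text \<open>Scaling by z = 0 loses the strict inequality, hence the alternative
  \<open>s > 0\<close>.\<close>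

lemma scaled_in_dominated_tensors:
  assumes "A \<in> dominated_tensors d n r" "cmod z * r \<le> s" "z \<noteq> 0 \<or> s > 0"
  shows "(\<lambda>js. z * A js) \<in> dominated_tensors d n s"
proof -
  have "slice_norm d n (\<lambda>js. z * A js) i < s" if "i \<in> {1..n}" for i
  proof -
    have eq: "slice_norm d n (\<lambda>js. z * A js) i = cmod z * slice_norm d n A i"
      by (simp add: slice_norm_def norm_mult sum_distrib_left)
    have "slice_norm d n A i < r" using assms(1) that by (simp add: dominated_tensors_def)
    then have "cmod z * slice_norm d n A i < cmod z * r" if "z \<noteq> 0"
      using that by simp
    then show ?thesis
      using assms(2,3) unfolding eq by (cases "z = 0") (simp, meson less_le_trans)
  qed
  then show ?thesis
    using assms(1) by (simp add: dominated_tensors_def tensors_def)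
qed

text \<open>For |z| \<le> 1 / r the tensor z A lies in the unit domain, where
  \<open>PER_nonzero\<close> excludes zeros of the line polynomial.\<close>

lemma norm_recip_roots_line_poly_less:
  assumes "d \<ge> 1" "n \<ge> 1" "r > 0" "A \<in> dominated_tensors d n r"
    "b \<in> set (recip_roots (line_poly d n A))"
  shows "cmod b < r"
proof (rule norm_recip_roots_less[OF coeff_0_line_poly[OF assms(1)] assms(3) _ assms(5)])
  fix z assume "cmod z \<le> 1 / r"
  then have "(\<lambda>js. z * A js) \<in> dominated_tensors d n 1"
    using assms(3,4) by (intro scaled_in_dominated_tensors) (auto simp: field_simps)
  then show "poly (line_poly d n A) z \<noteq> 0"
    using PER_nonzero[OF assms(1,2)] by (simp add: poly_line_poly)
qed

text \<open>Principal logarithms are taken factor by factor: on the unit domain every |b| < 1, so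
  each 1 - b stays off the branch cut, while the permanent itself may wind around 0.\<close>

definition log_PER :: "nat \<Rightarrow> nat \<Rightarrow> (nat list \<Rightarrow> complex) \<Rightarrow> complex" where
  "log_PER d n A = (\<Sum>b\<leftarrow>recip_roots (line_poly d n A). Ln (1 - b))"

text \<open>The Taylor section of order \<open>m\<close> in \<open>z\<close> of ln PER (I + z A),
  taken at z = 1.\<close>

definition log_PER_trunc :: "nat \<Rightarrow> nat \<Rightarrow> nat \<Rightarrow> (nat list \<Rightarrow> complex) \<Rightarrow> complex" where
  "log_PER_trunc d n m A = - (\<Sum>k=1..m. power_sum (line_poly d n A) k / of_nat k)"

lemma poly_fun_log_PER_trunc:
  assumes "d \<ge> 1"
  shows "poly_fun (tensor_indices d n) m (log_PER_trunc d n m)"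
proof -
  have "poly_fun (tensor_indices d n) m
      (\<lambda>A. \<Sum>k=1..m. (- 1 / of_nat k) * power_sum (line_poly d n A) k)"
  proof (intro poly_fun_sum poly_fun_cmult)
    fix k assume "k \<in> {1..m}"
    then have "poly_fun (tensor_indices d n) k (\<lambda>A. power_sum (line_poly d n A) k)" "k \<le> m"
      using poly_fun_power_sum_line_poly[OF assms, of n "k - 1"] by auto
    then show "poly_fun (tensor_indices d n) m (\<lambda>A. power_sum (line_poly d n A) k)"
      by (rule poly_fun_mono)
  qed
  moreover have "log_PER_trunc d n m = (\<lambda>A. \<Sum>k=1..m. (- 1 / of_nat k) * power_sum (line_poly d n A) k)"
    by (simp add: log_PER_trunc_def fun_eq_iff sum_negf)
  ultimately show ?thesis by simp
qed

text \<open>There are at most \<open>n\<close> reciprocal roots, all of modulus below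
  \<open>r\<close>, and each contributes one geometric tail.\<close>

lemma norm_log_PER_diff_trunc_le:
  assumes "d \<ge> 1" "n \<ge> 1" "0 < r" "r < 1" "A \<in> dominated_tensors d n r"
  shows "cmod (log_PER d n A - log_PER_trunc d n m A) \<le> real n * (r ^ Suc m / (1 - r))"
proof -
  let ?bs = "recip_roots (line_poly d n A)"
  have "cmod (log_PER d n A - log_PER_trunc d n m A) \<le> real (length ?bs) * (r ^ Suc m / (1 - r))"
    unfolding log_PER_def log_PER_trunc_def power_sum_def diff_minus_eq_add
    using norm_recip_roots_line_poly_less[OF assms(1,2,3,5)] assms(4)
    by (intro norm_sum_Ln_truncation_le) (auto intro: less_imp_le)
  also have "\<dots> \<le> real n * (r ^ Suc m / (1 - r))"
    using recip_roots(1)[OF coeff_0_line_poly[OF assms(1)]] degree_line_poly_le assms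
    by (intro mult_right_mono) auto
  finally show ?thesis .
qed

text \<open>Evaluate the factorisation of the line polynomial at 1; every 1 - b is nonzero because
  |b| < 1.\<close>

lemma exp_log_PER:
  assumes "d \<ge> 1" "n \<ge> 1" "A \<in> dominated_tensors d n 1"
  shows "exp (log_PER d n A) = PER d n (\<lambda>js. id_tensor d n js + A js)"
proof -
  let ?bs = "recip_roots (line_poly d n A)"
  have exp_sum: "exp (\<Sum>b\<leftarrow>bs. Ln (1 - b)) = (\<Prod>b\<leftarrow>bs. 1 - b)"
    if "\<forall>b\<in>set bs. b \<noteq> 1" for bs :: "complex list"
    using that by (induction bs) (auto simp: exp_add)
  have "b \<noteq> 1" if "b \<in> set ?bs" for b
    using norm_recip_roots_line_poly_less[OF assms(1,2) _ assms(3) that] by auto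
  then have "exp (log_PER d n A) = (\<Prod>b\<leftarrow>?bs. 1 - b)"
    by (simp add: log_PER_def exp_sum)
  also have "\<dots> = poly (\<Prod>b\<leftarrow>?bs. [:1, - b:]) 1"
    by (simp add: poly_prod_list o_def)
  also have "\<dots> = poly (line_poly d n A) 1"
    by (simp flip: recip_roots(2)[OF coeff_0_line_poly[OF assms(1)]])
  also have "\<dots> = PER d n (\<lambda>js. id_tensor d n js + A js)"
    by (simp add: poly_line_poly)
  finally show ?thesis .
qed

text \<open>The zero tensor lies in the domain of every positive radius, so a nonzero reciprocal
  root \<open>b\<close> would satisfy |b| < |b|.\<close>

lemma log_PER_zero:
  assumes "d \<ge> 1" "n \<ge> 1"
  shows "log_PER d n (\<lambda>_. 0) = 0"
proof -
  have "b = 0" if "b \<in> set (recip_roots (line_poly d n (\<lambda>_. 0)))" for b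
  proof (rule ccontr)
    assume "b \<noteq> 0"
    moreover have "(\<lambda>_. 0) \<in> dominated_tensors d n (cmod b)"
      using \<open>b \<noteq> 0\<close> by (simp add: dominated_tensors_def tensors_def slice_norm_def)
    ultimately show False
      using norm_recip_roots_line_poly_less[OF assms _ _ that, of "cmod b"] by simp
  qed
  then have "Ln (1 - b) = 0" if "b \<in> set (recip_roots (line_poly d n (\<lambda>_. 0)))" for b
    using that by fastforce
  then show ?thesis unfolding log_PER_def by (simp cong: map_cong)
qed

section \<open>Continuity of the branch\<close>

lemma continuous_on_slice_norm: "continuous_on S (\<lambda>A. slice_norm d n A i)"
  unfolding slice_norm_def
  by (intro continuous_intros continuous_on_subset[OF continuous_on_product_coordinates]) auto

text \<open>The chosen list of roots carries no continuity in \<open>A\<close>. Instead, the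
  truncations are polynomials in the entries and converge uniformly once the radius is a fixed
  \<open>r\<close> below 1.\<close>

lemma log_PER_continuous_on_smaller:
  assumes "d \<ge> 1" "n \<ge> 1" "0 < r" "r < 1"
  shows "continuous_on (dominated_tensors d n r) (log_PER d n)"
proof (rule uniform_limit_theorem)
  show "\<forall>\<^sub>F m in sequentially. continuous_on (dominated_tensors d n r) (log_PER_trunc d n m)"
    using poly_fun_continuous_on[OF poly_fun_log_PER_trunc[OF assms(1)]] by simp
  have "(\<lambda>m. real n * (r ^ Suc m / (1 - r))) \<longlonglongrightarrow> real n * (0 / (1 - r))"
    using assms by (intro tendsto_intros LIMSEQ_Suc LIMSEQ_realpow_zero) auto
  then have "(\<lambda>m. real n * (r ^ Suc m / (1 - r))) \<longlonglongrightarrow> 0" by simp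
  show "uniform_limit (dominated_tensors d n r) (log_PER_trunc d n) (log_PER d n) sequentially"
  proof (rule uniform_limitI)
    fix e :: real assume "e > 0"
    with \<open>(\<lambda>m. real n * (r ^ Suc m / (1 - r))) \<longlonglongrightarrow> 0\<close>
    have "\<forall>\<^sub>F m in sequentially. real n * (r ^ Suc m / (1 - r)) < e"
      by (rule order_tendstoD)
    then show "\<forall>\<^sub>F m in sequentially. \<forall>A\<in>dominated_tensors d n r.
        dist (log_PER_trunc d n m A) (log_PER d n A) < e"
    proof eventually_elim
      case (elim m)
      show ?case
      proof
        fix A assume "A \<in> dominated_tensors d n r"
        from norm_log_PER_diff_trunc_le[OF assms this, of m] elim
        show "dist (log_PER_trunc d n m A) (log_PER d n A) < e"
          by (simp add: dist_commute dist_norm)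
      qed
    qed
  qed
qed simp

text \<open>Continuity is local: finitely many slice norms below 1 lie below a common r < 1, and
  they stay below \<open>r\<close> on an open neighbourhood of \<open>A\<close>.\<close>

lemma log_PER_continuous_on:
  assumes "d \<ge> 1" "n \<ge> 1"
  shows "continuous_on (dominated_tensors d n 1) (log_PER d n)"
  unfolding continuous_on_def
proof
  fix A assume A: "A \<in> dominated_tensors d n 1"
  let ?M = "Max ((slice_norm d n A) ` {1..n})"
  have "?M \<in> (slice_norm d n A) ` {1..n}" using assms(2) by (intro Max_in) auto
  then have "?M < 1" using A by (auto simp: dominated_tensors_def)
  \<comment> \<open>The maximum with 0 secures \<open>r > 0\<close>.\<close>
  then obtain r where r: "max 0 ?M < r" "r < 1" using dense[of "max 0 ?M" 1] by auto
  define U where "U = (\<Inter>i\<in>{1..n}. {A. slice_norm d n A i < r})"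
  have "open U"
    unfolding U_def by (intro open_INT ballI open_Collect_less continuous_on_slice_norm) auto
  have Dr: "dominated_tensors d n 1 \<inter> U = dominated_tensors d n r"
    using r(2) by (force simp: U_def dominated_tensors_def)
  have "slice_norm d n A i < r" if "i \<in> {1..n}" for i
    using r(1) that Max_ge[of "(slice_norm d n A) ` {1..n}" "slice_norm d n A i"] by fastforce
  then have "A \<in> U" by (simp add: U_def)
  have "at A within dominated_tensors d n 1 = at A within dominated_tensors d n r"
    using Dr by (intro at_within_nhd[OF \<open>A \<in> U\<close> \<open>open U\<close>]) auto
  moreover have "A \<in> dominated_tensors d n r" using Dr A \<open>A \<in> U\<close> by blast
  ultimately show "(log_PER d n \<longlongrightarrow> log_PER d n A) (at A within dominated_tensors d n 1)"
    using log_PER_continuous_on_smaller[OF assms, of r] r by (simp add: continuous_on_def)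
qed

lemma is_ln_PER_branch_log_PER:
  assumes "d \<ge> 1" "n \<ge> 1"
  shows "is_ln_PER_branch d n (log_PER d n)"
  using log_PER_continuous_on exp_log_PER log_PER_zero assms by (simp add: is_ln_PER_branch_def)

text \<open>Along the segment from 0 to \<open>A\<close> the difference of two branches is
  continuous with values in the multiples of 2 pi i; it is therefore constant, and it starts at
  0.\<close>

lemma is_ln_PER_branch_unique:
  assumes "is_ln_PER_branch d n L" "is_ln_PER_branch d n L'" "A \<in> dominated_tensors d n 1"
  shows "L A = L' A"
proof -
  define \<gamma> where "\<gamma> t = (\<lambda>js. complex_of_real t * A js)" for t
  define g where "g t = L (\<gamma> t) - L' (\<gamma> t)" for t
  have \<gamma>: "\<gamma> t \<in> dominated_tensors d n 1" if "t \<in> {0..1}" for t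
    using that assms(3) unfolding \<gamma>_def by (intro scaled_in_dominated_tensors[of A d n 1]) auto
  have "continuous_on {0..1} \<gamma>"
    unfolding \<gamma>_def by (intro continuous_on_coordinatewise_then_product continuous_intros)
  then have "continuous_on {0..1} (\<lambda>t. F (\<gamma> t))" if "is_ln_PER_branch d n F" for F
    using \<gamma> that unfolding is_ln_PER_branch_def by (intro continuous_on_compose2[of _ F _ \<gamma>]) auto
  then have "continuous_on {0..1} g"
    unfolding g_def using assms by (intro continuous_intros) auto
  have exp_g: "exp (g t) = 1" if "t \<in> {0..1}" for t
  proof -
    have "exp (L (\<gamma> t)) = exp (L' (\<gamma> t))"
      using assms(1,2) \<gamma>[OF that] by (simp add: is_ln_PER_branch_def)
    then show ?thesis by (simp add: g_def exp_diff)
  qed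
  have "g constant_on {0..1}"
  proof (rule continuous_discrete_range_constant[OF _ \<open>continuous_on {0..1} g\<close>])
    fix t :: real assume t: "t \<in> {0..1}"
    \<comment> \<open>Distinct values are at least 2 pi apart; the weaker gap \<open>pi\<close>
      serves as \<open>e\<close>.\<close>
    show "\<exists>e>0. \<forall>s. s \<in> {0..1} \<and> g s \<noteq> g t \<longrightarrow> e \<le> cmod (g s - g t)"
    proof (intro exI conjI allI impI)
      fix s assume s: "s \<in> {0..1} \<and> g s \<noteq> g t"
      then have "exp (g s - g t) = 1" using t exp_g by (simp add: exp_diff)
      then obtain k where k: "Re (g s - g t) = 0" "Im (g s - g t) = of_int (2 * k) * pi"
        by (auto simp: exp_eq_1)
      then have "k \<noteq> 0" using s by (auto simp: complex_eq_iff)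
      then have "1 \<le> \<bar>real_of_int (2 * k)\<bar>" by linarith
      then have "1 * pi \<le> \<bar>real_of_int (2 * k)\<bar> * pi" by (intro mult_right_mono) auto
      also have "\<dots> = \<bar>Im (g s - g t)\<bar>" by (simp only: k(2) abs_mult abs_of_pos[OF pi_gt_zero])
      also have "\<dots> \<le> cmod (g s - g t)" by (rule abs_Im_le_cmod)
      finally show "pi \<le> cmod (g s - g t)" by simp
    qed simp
  qed simp
  then have "g 1 = g 0" by (force simp: constant_on_def)
  moreover have "g 0 = 0" using assms(1,2) by (simp add: g_def \<gamma>_def is_ln_PER_branch_def)
  ultimately show ?thesis by (simp add: g_def \<gamma>_def)
qed

lemma ln_PER_eq_log_PER:
  assumes "d \<ge> 1" "n \<ge> 1" "A \<in> dominated_tensors d n 1"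
  shows "ln_PER d n A = log_PER d n A"
  unfolding ln_PER_def
  using is_ln_PER_branch_log_PER[OF assms(1,2)] is_ln_PER_branch_unique[OF _ _ assms(3)]
  by (intro the_equality) blast+

section \<open>Choice of the truncation order and the final estimate\<close>

lemma truncation_order_exists:
  fixes r :: real
  assumes "0 < r" "r < 1"
  shows "\<exists>C>0. \<forall>n \<epsilon>. n \<ge> 1 \<longrightarrow> 0 < \<epsilon> \<longrightarrow> \<epsilon> < 1 \<longrightarrow>
    (\<exists>m. real m \<le> C * (ln (real (max 2 n)) - ln \<epsilon>) \<and> real n * (r ^ Suc m / (1 - r)) \<le> \<epsilon>)"
proof -
  define a where "a = - ln r"
  define b where "b = - ln (1 - r)"
  \<comment> \<open>With X = ln (max 2 n) - ln \<epsilon>, taking logarithms shows that any m \<ge>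
    (X + b) / a makes the error at most \<epsilon>. Rounding up adds at most 1, so m \<le> X / a +
    (b / a + 1), and this must be at most C X.\<close>
  define C where "C = 1 / a + (b / a + 1) / ln 2"
  have ab: "a > 0" "b > 0" using assms by (auto simp: a_def b_def)
  have "C > 0" unfolding C_def using ab by (intro add_pos_pos divide_pos_pos) auto
  moreover have "\<exists>m. real m \<le> C * (ln (real (max 2 n)) - ln \<epsilon>) \<and> real n * (r ^ Suc m / (1 - r)) \<le> \<epsilon>"
    if n: "n \<ge> 1" and \<epsilon>: "0 < \<epsilon>" "\<epsilon> < 1" for n :: nat and \<epsilon> :: real
  proof -
    define X where "X = ln (real (max 2 n)) - ln \<epsilon>"
    define m where "m = nat \<lceil>(X + b) / a\<rceil>"
    have "ln \<epsilon> < 0" using \<epsilon> by simp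
    moreover have "ln 2 \<le> ln (real (max 2 n))" by (subst ln_le_cancel_iff) auto
    ultimately have X: "X \<ge> ln 2" unfolding X_def by linarith
    moreover have "ln 2 > (0 :: real)" by simp
    ultimately have "X > 0" by linarith
    have "(X + b) / a > 0" using ab \<open>X > 0\<close> by simp
    then have m: "(X + b) / a \<le> real m" "real m \<le> (X + b) / a + 1"
      unfolding m_def by linarith+
    have "real m \<le> X / a + (b / a + 1) * 1" using m(2) by (simp add: add_divide_distrib)
    \<comment> \<open>The additive constant is absorbed through X \<ge> ln 2, which holds thanks to
      \<open>max 2 n\<close>.\<close>
    also have "\<dots> \<le> X / a + (b / a + 1) * (X / ln 2)"
      using X ab \<open>ln 2 > (0 :: real)\<close> by (intro add_left_mono mult_left_mono) auto
    also have "\<dots> = C * X" by (simp add: C_def distrib_right)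
    finally have "real m \<le> C * X" .
    moreover have "real n * (r ^ Suc m / (1 - r)) \<le> \<epsilon>"
    proof -
      have "X + b \<le> a * real m" using m(1) ab by (simp add: pos_divide_le_eq mult.commute)
      also have "\<dots> \<le> a * real (Suc m)" using ab by simp
      finally have "ln (real (max 2 n)) - ln \<epsilon> - ln (1 - r) \<le> - ln r * real (Suc m)"
        by (simp add: X_def a_def b_def)
      moreover have "ln (real n) \<le> ln (real (max 2 n))" using n by (subst ln_le_cancel_iff) auto
      ultimately have "ln (real n) + real (Suc m) * ln r - ln (1 - r) \<le> ln \<epsilon>"
        by (simp add: mult.commute)
      moreover have "ln (real n * (r ^ Suc m / (1 - r))) = ln (real n) + real (Suc m) * ln r - ln (1 - r)"
      proof -
        have "r ^ Suc m > 0" using assms by simp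
        then have "ln (real n * (r ^ Suc m / (1 - r))) = ln (real n) + (ln (r ^ Suc m) - ln (1 - r))"
          using n assms by (simp add: ln_mult_pos ln_divide_pos del: power_Suc)
        then show ?thesis using assms by (simp only: ln_realpow)
      qed
      ultimately have "ln (real n * (r ^ Suc m / (1 - r))) \<le> ln \<epsilon>" by simp
      moreover have "real n * (r ^ Suc m / (1 - r)) > 0" using n assms by simp
      ultimately show ?thesis using \<epsilon>(1) by simp
    qed
    ultimately show ?thesis unfolding X_def by blast
  qed
  ultimately show ?thesis by blast
qed

theorem theorem1p6:
  fixes lam :: real
  assumes "0 < lam" and "lam < 1"
  shows "\<exists>C::real. C > 0 \<and>
    (\<forall>d n::nat. \<forall>\<epsilon>::real. d \<ge> 2 \<longrightarrow> n \<ge> 1 \<longrightarrow> 0 < \<epsilon> \<longrightarrow> \<epsilon> < 1 \<longrightarrow>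
      (\<exists>p :: nat list cpoly.
         cpoly_vars p \<subseteq> tensor_indices d n \<and>
         real (cpoly_degree p) \<le> C * (ln (real (max 2 n)) - ln \<epsilon>) \<and>
         (\<forall>A \<in> tensors d n.
            (\<forall>i\<in>{1..n}. (\<Sum>js \<in> tensor_indices (d - 1) n. cmod (A (i # js))) < lam) \<longrightarrow>
            cmod (ln_PER d n A - cpoly_eval p A) \<le> \<epsilon>)))"
proof -
  \<comment> \<open>The constant is fixed before \<open>d\<close>, \<open>n\<close> and \<epsilon>,
    and the error bound does not involve \<open>d\<close>; it depends on \<open>lam\<close>
    alone.\<close>
  obtain C where "C > 0" and C: "\<And>n \<epsilon>. n \<ge> 1 \<Longrightarrow> 0 < \<epsilon> \<Longrightarrow> \<epsilon> < 1 \<Longrightarrow>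
      \<exists>m. real m \<le> C * (ln (real (max 2 n)) - ln \<epsilon>) \<and> real n * (lam ^ Suc m / (1 - lam)) \<le> \<epsilon>"
    using truncation_order_exists[OF assms] by blast
  show ?thesis
  proof (intro exI[of _ C] conjI allI impI)
    fix d n :: nat and \<epsilon> :: real
    assume d: "d \<ge> 2" and n: "n \<ge> 1" and \<epsilon>: "0 < \<epsilon>" "\<epsilon> < 1"
    then have "d \<ge> 1" by simp
    obtain m where m: "real m \<le> C * (ln (real (max 2 n)) - ln \<epsilon>)"
      "real n * (lam ^ Suc m / (1 - lam)) \<le> \<epsilon>"
      using C[OF n \<epsilon>] by blast
    \<comment> \<open>The approximant is the truncated logarithm of order \<open>m\<close>, whose
      degree in the entries is at most \<open>m\<close>.\<close>
    obtain p where p: "cpoly_vars p \<subseteq> tensor_indices d n" "cpoly_degree p \<le> m"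
      "\<And>A. cpoly_eval p A = log_PER_trunc d n m A"
      using poly_fun_log_PER_trunc[OF \<open>d \<ge> 1\<close>, of n m] unfolding poly_fun_def by blast
    have "real (cpoly_degree p) \<le> C * (ln (real (max 2 n)) - ln \<epsilon>)"
      using p(2) m(1) by linarith
    moreover have "cmod (ln_PER d n A - cpoly_eval p A) \<le> \<epsilon>"
      if "A \<in> tensors d n" "\<forall>i\<in>{1..n}. (\<Sum>js \<in> tensor_indices (d - 1) n. cmod (A (i # js))) < lam" for A
    proof -
      have A: "A \<in> dominated_tensors d n lam"
        using that by (simp add: dominated_tensors_def slice_norm_def)
      then have "A \<in> dominated_tensors d n 1"
        using dominated_tensors_mono[of lam 1 d n] assms(2) by auto
      then have "ln_PER d n A = log_PER d n A" by (rule ln_PER_eq_log_PER[OF \<open>d \<ge> 1\<close> n])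
      then show ?thesis
        using norm_log_PER_diff_trunc_le[OF \<open>d \<ge> 1\<close> n assms A, of m] m(2) p(3) by simp
    qed
    ultimately show "\<exists>p :: nat list cpoly. cpoly_vars p \<subseteq> tensor_indices d n \<and>
         real (cpoly_degree p) \<le> C * (ln (real (max 2 n)) - ln \<epsilon>) \<and>
         (\<forall>A \<in> tensors d n.
            (\<forall>i\<in>{1..n}. (\<Sum>js \<in> tensor_indices (d - 1) n. cmod (A (i # js))) < lam) \<longrightarrow>
            cmod (ln_PER d n A - cpoly_eval p A) \<le> \<epsilon>)"
      using p(1) by blast
  qed (rule \<open>C > 0\<close>)
qed

end
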